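(* For every integer $l\ge0$ (and $|q|<1$), $$\sum_{m\ge0}\frac{q^m}{(q;q)_m(q;q)_{m+l}}=\frac{1}{(q;q)_\infty^2}\sum_{s\ge0}(-1)^sq^{\frac{s(s+1)}{2}+sl},$$ $$\sum_{m\ge0}\frac{q^{m^2+(l+1)m}}{(q;q)_m(q;q)_{m+l}}=\frac{1}{(q;q)_\infty}\sum_{s\ge0}(-1)^sq^{\frac{s(s+1)}{2}+sl}.$$
   Context: $(a;q)_n=\prod_{j=0}^{n-1}(1-aq^j)$ and $(a;q)_\infty=\prod_{j=0}^{\infty}(1-aq^j)$ for $|q|<1$. *)

theory Defs
  imports "HOL-Analysis.Analysis"
begin

definition qpoch :: "complex \<Rightarrow> complex \<Rightarrow> nat \<Rightarrow> complex" where
  "qpoch a q n = (\<Prod>j<n. 1 - a * q ^ j)"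

definition qpoch_inf :: "complex \<Rightarrow> complex \<Rightarrow> complex" where
  "qpoch_inf a q = prodinf (\<lambda>j. 1 - a * q ^ j)"

text \<open>For \<open>norm q < 1\<close> the infinite product converges (vanishing factors are allowed), so
  \<^const>\<open>qpoch_inf\<close> is its genuine value.\<close>

lemma convergent_prod_qpoch_inf:
  fixes a q :: complex
  assumes "norm q < 1"
  shows "convergent_prod (\<lambda>j. 1 - a * q ^ j)"
proof -
  have "summable (\<lambda>j. norm (- (a * q ^ j)))"
    using assms by (simp add: norm_mult norm_power summable_mult summable_geometric)
  then have "summable (\<lambda>j. norm ((1 - a * q ^ j) - 1))"
    by simp
  then have "abs_convergent_prod (\<lambda>j. 1 - a * q ^ j)"
    by (simp add: abs_convergent_prod_conv_summable)
  then show ?thesis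
    by (rule abs_convergent_prod_imp_convergent_prod)
qed

end

theory Submission
  imports Defs
begin

text \<open>Write \<open>T\<^sub>l\<close> for the alternating series. It satisfies \<open>T\<^sub>l = 1 - q\<^bsup>l+1\<^esup> T\<^bsub>l+1\<^esub>\<close>, and a bounded
  sequence with \<open>X\<^sub>l = c - q\<^bsup>l+1\<^esup> X\<^bsub>l+1\<^esub>\<close> must be \<open>c T\<^sub>l\<close>. Both left-hand sides satisfy such a
  recurrence. For the first one, the terms of \<open>X\<^sub>l + q\<^bsup>l+1\<^esup> X\<^bsub>l+1\<^esub>\<close> telescope. For the second one,
  \<open>X\<^sub>l + q\<^bsup>l+1\<^esup> X\<^bsub>l+1\<^esub>\<close> is the Durfee rectangle series \<open>C\<^sub>k\<close> with \<open>k = l + 1\<close>; the difference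
  \<open>C\<^sub>k - C\<^bsub>k+1\<^esub>\<close> telescopes to zero, so \<open>C\<^sub>k\<close> equals its limit \<open>1 / (q;q)\<^sub>\<infinity>\<close> as \<open>k \<rightarrow> \<infinity>\<close>.\<close>

section \<open>Finite q-products and geometric majorants\<close>

lemma qpoch_0 [simp]: "qpoch a q 0 = 1"
  by (simp add: qpoch_def)

lemma qpoch_Suc: "qpoch a q (Suc n) = qpoch a q n * (1 - a * q ^ n)"
  by (simp add: qpoch_def)

lemma norm_power_le_power:
  fixes q :: "'a::real_normed_div_algebra"
  assumes "norm q < 1" "m \<le> n"
  shows "norm (q ^ n) \<le> norm q ^ m"
  using assms by (simp add: norm_power power_decreasing)

lemma le_triangular: "s \<le> s * (s + 1) div 2" for s :: nat
  by (induction s) auto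

lemma sums_of_norm_le_geometric:
  fixes f :: "nat \<Rightarrow> 'a::banach"
  assumes "0 \<le> x" "x < 1" "\<And>m. norm (f m) \<le> K * x ^ m"
  shows "f sums suminf f" and "norm (suminf f) \<le> K / (1 - x)"
proof -
  have g: "(\<lambda>m. K * x ^ m) sums (K * (1 / (1 - x)))"
    using assms by (intro sums_mult geometric_sums) simp
  show "f sums suminf f"
    by (rule summable_sums, rule summable_comparison_test'[OF sums_summable[OF g]]) (rule assms)
  have "norm (suminf f) \<le> (\<Sum>m. K * x ^ m)"
    by (rule norm_suminf_le[OF assms(3) sums_summable[OF g]])
  then show "norm (suminf f) \<le> K / (1 - x)"
    using sums_unique[OF g] by simp
qed

context
  fixes q :: complex
  assumes q: "norm q < 1"
begin

section \<open>Nonvanishing, limit and boundedness for the products (q;q)_n\<close>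

lemma one_minus_power_nonzero: "1 - q ^ Suc n \<noteq> 0"
proof
  assume "1 - q ^ Suc n = 0"
  then have "norm (q ^ Suc n) = 1" by simp
  moreover have "norm (q ^ Suc n) \<le> norm q ^ 1"
    by (rule norm_power_le_power[OF q]) simp
  ultimately show False
    using q by simp
qed

lemma qpoch_nonzero: "qpoch q q n \<noteq> 0"
  using one_minus_power_nonzero by (simp add: qpoch_def)

lemma qpoch_inf_nonzero: "qpoch_inf q q \<noteq> 0"
  unfolding qpoch_inf_def
  using one_minus_power_nonzero
  by (intro prodinf_nonzero convergent_prod_qpoch_inf q) simp

lemma qpoch_tendsto: "qpoch q q \<longlonglongrightarrow> qpoch_inf q q"
proof -
  \<comment> \<open>The limit of a convergent product is stated for products over j <= n, hence the
    shift to \<open>Suc n\<close>.\<close>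
  have "(\<lambda>n. qpoch q q (Suc n)) \<longlonglongrightarrow> qpoch_inf q q"
    using convergent_prod_LIMSEQ[OF convergent_prod_qpoch_inf[OF q, of q]]
    by (simp add: qpoch_def qpoch_inf_def lessThan_Suc_atMost)
  then show ?thesis
    by (rule LIMSEQ_imp_Suc)
qed

lemma inverse_qpoch_tendsto: "(\<lambda>n. 1 / qpoch q q n) \<longlonglongrightarrow> 1 / qpoch_inf q q"
  by (intro tendsto_intros qpoch_tendsto qpoch_inf_nonzero)

text \<open>A convergent sequence is bounded. One \<open>K\<close> serves all pairs of indices,
  which makes the later series bounds independent of the shift.\<close>

lemma inverse_qpoch_bounded:
  obtains K where "\<And>m n. norm (1 / (qpoch q q m * qpoch q q n)) \<le> K"
proof -
  obtain M where M: "M > 0" "\<And>n. norm (1 / qpoch q q n) \<le> M"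
    using convergent_imp_Bseq[OF convergentI[OF inverse_qpoch_tendsto]] by (auto elim!: BseqE)
  have "norm (1 / (qpoch q q m * qpoch q q n)) \<le> M * M" for m n
    using mult_mono[OF M(2)[of m] M(2)[of n]] M(1) by (simp add: norm_mult norm_divide)
  then show ?thesis
    by (rule that)
qed

section \<open>The alternating series and its recurrence\<close>

lemma alternating_summable: "summable (\<lambda>s. (-1) ^ s * q ^ (s * (s + 1) div 2 + s * l))"
proof (rule sums_summable, rule sums_of_norm_le_geometric(1))
  show "norm ((-1) ^ s * q ^ (s * (s + 1) div 2 + s * l)) \<le> 1 * norm q ^ s" for s
    using norm_power_le_power[OF q, of s "s * (s + 1) div 2 + s * l"] le_triangular[of s]
    by (simp add: norm_mult norm_power)
qed (use q in auto)

text \<open>Unrolling the recurrence \<open>n\<close> times gives \<open>c\<close> times a partial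
  sum plus the remainder \<open>t n * X (l + n)\<close>. Since \<open>t n\<close> tends to 0 and
  \<open>X\<close> is bounded, the remainder vanishes in the limit.\<close>

lemma bounded_recurrence_solution:
  fixes X :: "nat \<Rightarrow> complex"
  assumes rec: "\<And>l. X l + q ^ (l + 1) * X (l + 1) = c"
    and bd: "\<And>l. norm (X l) \<le> K"
  shows "X l = c * (\<Sum>s. (-1) ^ s * q ^ (s * (s + 1) div 2 + s * l))"
proof -
  define t where "t s = (-1) ^ s * q ^ (s * (s + 1) div 2 + s * l)" for s
  have iter: "X l - c * (\<Sum>s<n. t s) = t n * X (l + n)" for n
  proof (induction n)
    case 0
    show ?case by (simp add: t_def)
  next
    case (Suc n)
    \<comment> \<open>The exponent grows by \<open>l + n + 1\<close>, exactly the power in the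
      recurrence at index \<open>l + n\<close>.\<close>
    have "Suc n * (Suc n + 1) div 2 + Suc n * l = (n * (n + 1) div 2 + n * l) + (l + n + 1)"
      by (simp add: algebra_simps)
    then have t_Suc: "t (Suc n) = - (t n * q ^ (l + n + 1))"
      unfolding t_def by (simp add: power_add)
    have "X l - c * (\<Sum>s<Suc n. t s) = t n * (X (l + n) - c)"
      using Suc by (simp add: algebra_simps)
    also have "X (l + n) - c = - (q ^ (l + n + 1) * X (l + Suc n))"
      using rec[of "l + n"] by (simp add: algebra_simps)
    finally show ?case
      by (simp add: t_Suc)
  qed
  have "t \<longlonglongrightarrow> 0"
    unfolding t_def by (rule summable_LIMSEQ_zero[OF alternating_summable])
  moreover have "Bfun (\<lambda>n. X (l + n)) sequentially"
    using bd by (intro BfunI[where K = K]) auto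
  ultimately have "(\<lambda>n. t n * X (l + n)) \<longlonglongrightarrow> 0"
    unfolding tendsto_Zfun_iff by (auto intro: bounded_bilinear.Zfun_prod_Bfun[OF bounded_bilinear_mult])
  moreover have "(\<lambda>n. X l - c * (\<Sum>s<n. t s)) \<longlonglongrightarrow> X l - c * suminf t"
    unfolding t_def by (intro tendsto_intros summable_LIMSEQ alternating_summable)
  ultimately have "X l - c * suminf t = 0"
    unfolding iter by (rule LIMSEQ_unique[rotated])
  then show ?thesis
    unfolding t_def by simp
qed

section \<open>Geometric bounds for the quotient series, uniform in the shift\<close>

lemma series_norm_le:
  assumes "\<And>m n. norm (1 / (qpoch q q m * qpoch q q n)) \<le> K" and "a \<le> e"
  shows "norm (q ^ e / (qpoch q q m * qpoch q q n)) \<le> K * norm q ^ a"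
proof -
  have "norm (q ^ e) * norm (1 / (qpoch q q m * qpoch q q n)) \<le> norm q ^ a * K"
    by (intro mult_mono norm_power_le_power q assms) auto
  then show ?thesis
    by (simp add: norm_mult norm_divide mult.commute)
qed

lemma series_sums:
  assumes "\<And>m. m \<le> e m"
  shows "(\<lambda>m. q ^ e m / (qpoch q q m * qpoch q q (m + k)))
    sums (\<Sum>m. q ^ e m / (qpoch q q m * qpoch q q (m + k)))"
proof -
  obtain K where "\<And>m n. norm (1 / (qpoch q q m * qpoch q q n)) \<le> K"
    using inverse_qpoch_bounded by blast
  from sums_of_norm_le_geometric(1)[OF norm_ge_zero q series_norm_le[OF this assms]]
  show ?thesis .
qed

text \<open>The majorant \<open>K * norm q ^ m\<close> does not involve \<open>k\<close>. This
  supplies the boundedness required by \<open>bounded_recurrence_solution\<close>.\<close>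

lemma series_bounded:
  assumes "\<And>m k. m \<le> e k m"
  obtains B where "\<And>k. norm (\<Sum>m. q ^ e k m / (qpoch q q m * qpoch q q (m + k))) \<le> B"
proof -
  obtain K where "\<And>m n. norm (1 / (qpoch q q m * qpoch q q n)) \<le> K"
    using inverse_qpoch_bounded by blast
  note sums_of_norm_le_geometric(2)[OF norm_ge_zero q series_norm_le[OF this assms]]
  then show ?thesis
    by (rule that)
qed

section \<open>The first series\<close>

lemma first_series_recurrence:
  defines "A \<equiv> \<lambda>l. \<Sum>m. q ^ m / (qpoch q q m * qpoch q q (m + l))"
  shows "A l + q ^ (l + 1) * A (l + 1) = 1 / (qpoch_inf q q)\<^sup>2"
proof -
  define a where "a l m = q ^ m / (qpoch q q m * qpoch q q (m + l))" for l m
  \<comment> \<open>The telescoping takes the form of a closed expression for the partial sums, a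
    product of two factors that each tend to \<open>1 / qpoch_inf q q\<close>.\<close>
  have "(\<Sum>m<Suc n. a l m + q ^ (l + 1) * a (l + 1) m)
      = 1 / qpoch q q n * (1 / qpoch q q (n + (l + 1)))" for n
  proof (induction n)
    case 0
    have "1 / P + u * (1 / (P * (1 - u))) = 1 / (P * (1 - u))"
      if "P \<noteq> 0" "1 - u \<noteq> 0" for P u :: complex
      using that by (simp add: divide_simps)
    from this[OF qpoch_nonzero one_minus_power_nonzero, of l l] show ?case
      by (simp add: a_def qpoch_Suc)
  next
    case (Suc n)
    \<comment> \<open>With denominators cleared, this is
      \<open>(1 - u) * (1 - u * v) + u * (1 - u * v) + u * v = 1\<close>.\<close>
    have "1 / P * (1 / R) + (u / (P * (1 - u) * R) + v * (u / (P * (1 - u) * (R * (1 - u * v)))))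
        = 1 / (P * (1 - u)) * (1 / (R * (1 - u * v)))"
      if "P \<noteq> 0" "R \<noteq> 0" "1 - u \<noteq> 0" "1 - u * v \<noteq> 0" for P R u v :: complex
      using that by (simp add: divide_simps) (simp add: algebra_simps)
    from this[of "qpoch q q n" "qpoch q q (n + (l + 1))" "q ^ Suc n" "q ^ (l + 1)"]
    show ?case
      using one_minus_power_nonzero[of n] one_minus_power_nonzero[of "n + l + 1"]
        qpoch_nonzero[of n] qpoch_nonzero[of "n + (l + 1)"] Suc
      by (simp add: a_def qpoch_Suc power_add mult_ac)
  qed
  moreover have "(\<lambda>n. 1 / qpoch q q n * (1 / qpoch q q (n + (l + 1))))
      \<longlonglongrightarrow> 1 / qpoch_inf q q * (1 / qpoch_inf q q)"
    by (intro tendsto_mult inverse_qpoch_tendsto LIMSEQ_ignore_initial_segment)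
  ultimately have "(\<lambda>n. \<Sum>m<Suc n. a l m + q ^ (l + 1) * a (l + 1) m)
      \<longlonglongrightarrow> 1 / qpoch_inf q q * (1 / qpoch_inf q q)"
    by simp
  then have "(\<lambda>m. a l m + q ^ (l + 1) * a (l + 1) m) sums (1 / (qpoch_inf q q)\<^sup>2)"
    \<comment> \<open>The closed form covers nonempty partial sums only, so the limit is taken along
      \<open>Suc n\<close>.\<close>
    unfolding sums_def by (subst filterlim_sequentially_Suc[symmetric]) (simp add: power2_eq_square)
  moreover have "(\<lambda>m. a l m + q ^ (l + 1) * a (l + 1) m) sums (A l + q ^ (l + 1) * A (l + 1))"
    unfolding a_def A_def by (intro sums_add sums_mult series_sums) auto
  ultimately show ?thesis
    using sums_unique2 by blast
qed

section \<open>Durfee rectangles and the second series\<close>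

text \<open>Combinatorially, partitions are sorted by the largest m by (m + k) rectangle in their
  diagram. The argument here is analytic: independence of \<open>k\<close>, then \<open>k\<close> to
  infinity.\<close>

lemma durfee_rectangle_identity:
  "(\<lambda>m. q ^ (m\<^sup>2 + k * m) / (qpoch q q m * qpoch q q (m + k))) sums (1 / qpoch_inf q q)"
proof -
  define c where "c k m = q ^ (m\<^sup>2 + k * m) / (qpoch q q m * qpoch q q (m + k))" for k m
  have c_sums: "c k sums suminf (c k)" for k
    unfolding c_def by (rule series_sums) (simp add: power2_eq_square trans_le_add1)
  obtain K where K: "\<And>m n. norm (1 / (qpoch q q m * qpoch q q n)) \<le> K"
    using inverse_qpoch_bounded by blast

  \<comment> \<open>This choice works because \<open>c k n - w k n\<close> and
    \<open>c (Suc k) n - w k (Suc n)\<close> both equal \<open>q ^ n * c k n\<close>. Moreover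
    \<open>w k 0 = 0\<close>.\<close>
  define w where "w k m = (1 - q ^ m) * c k m" for k m
  have tele: "(\<Sum>m<n. c k m - c (Suc k) m) = - w k n" for k n
  proof (induction n)
    case 0
    show ?case by (simp add: w_def)
  next
    case (Suc n)
    have "c k n - c (Suc k) n = w k n - w k (Suc n)"
    proof -
      have "z / (P * R) - z * x / (P * (R * (1 - q * (x * y))))
          = (1 - x) * (z / (P * R))
            - (1 - q * x) * (z * x * x * y * q / (P * (1 - q * x) * (R * (1 - q * (x * y)))))"
        if "P \<noteq> 0" "R \<noteq> 0" "1 - q * x \<noteq> 0" "1 - q * (x * y) \<noteq> 0" for P R x y z :: complex
        using that by (simp add: divide_simps) (simp add: algebra_simps)
      from this[of "qpoch q q n" "qpoch q q (n + k)" "q ^ n" "q ^ k" "q ^ (n\<^sup>2 + k * n)"]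
      show ?thesis
        using one_minus_power_nonzero[of n] one_minus_power_nonzero[of "n + k"]
          qpoch_nonzero[of n] qpoch_nonzero[of "n + k"]
        by (simp add: c_def w_def qpoch_Suc power_add power2_eq_square mult_ac)
    qed
    with Suc show ?case by simp
  qed
  have "suminf (c k) = suminf (c (Suc k))" for k
  proof -
    \<comment> \<open>The boundary term of the telescoping vanishes, since \<open>c k n\<close> is
      the general term of a convergent series.\<close>
    have "(\<lambda>n. (1 - q ^ n) * c k n) \<longlonglongrightarrow> (1 - 0) * 0"
      using q by (intro tendsto_intros LIMSEQ_power_zero
          summable_LIMSEQ_zero sums_summable[OF c_sums])
    then have "(\<lambda>m. c k m - c (Suc k) m) sums (- 0)"
      unfolding sums_def tele w_def by (intro tendsto_minus) simp
    moreover have "(\<lambda>m. c k m - c (Suc k) m) sums (suminf (c k) - suminf (c (Suc k)))"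
      by (intro sums_diff c_sums)
    ultimately have "suminf (c k) - suminf (c (Suc k)) = - 0"
      using sums_unique2 by blast
    then show ?thesis by simp
  qed
  then have const: "suminf (c k) = suminf (c 0)" for k
    by (induction k) auto

  \<comment> \<open>The term of \<open>c k\<close> at 0 is \<open>1 / qpoch q q k\<close>. All later
    terms carry a factor \<open>q ^ k\<close>, so their sum is O(|q|^k).\<close>
  have "norm (suminf (c 0) - 1 / qpoch q q k) \<le> K * norm q ^ k / (1 - norm q)" for k
  proof -
    have "norm (c k (Suc m)) \<le> (K * norm q ^ k) * norm q ^ m" for m
      unfolding c_def
      using series_norm_le[OF K, of "k + m" "(Suc m)\<^sup>2 + k * Suc m"]
      by (simp add: power_add power2_eq_square mult.assoc)
    then have "norm (\<Sum>m. c k (Suc m)) \<le> K * norm q ^ k / (1 - norm q)"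
      using q by (intro sums_of_norm_le_geometric(2)) auto
    moreover have "(\<Sum>m. c k (Suc m)) = suminf (c k) - c k 0"
      by (rule suminf_split_head[OF sums_summable[OF c_sums]])
    ultimately show ?thesis
      unfolding const[of k, symmetric] by (simp add: c_def)
  qed
  then have bound: "\<forall>\<^sub>F k in sequentially.
      norm (suminf (c 0) - 1 / qpoch q q k) \<le> K * norm q ^ k / (1 - norm q)"
    by simp
  have "(\<lambda>k. K * norm q ^ k / (1 - norm q)) \<longlonglongrightarrow> K * 0 / (1 - norm q)"
    using q by (intro tendsto_intros LIMSEQ_power_zero) auto
  then have "(\<lambda>k. suminf (c 0) - 1 / qpoch q q k) \<longlonglongrightarrow> 0"
    by (intro Lim_null_comparison[OF bound]) simp
  moreover have "(\<lambda>k. suminf (c 0) - 1 / qpoch q q k) \<longlonglongrightarrow> suminf (c 0) - 1 / qpoch_inf q q"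
    by (intro tendsto_intros inverse_qpoch_tendsto)
  ultimately have "suminf (c 0) - 1 / qpoch_inf q q = 0"
    by (rule LIMSEQ_unique[rotated])
  then show ?thesis
    using c_sums[of k] const[of k] by (simp add: c_def [abs_def])
qed

text \<open>The combination works term by term: \<open>1 + y / (1 - y) = 1 / (1 - y)\<close> with
  \<open>y = q ^ (m + l + 1)\<close> turns (q;q)_{m+l} in the denominator into (q;q)_{m+l+1}, which
  gives the Durfee rectangle series for \<open>l + 1\<close>.\<close>

lemma second_series_recurrence:
  defines "B \<equiv> \<lambda>l. \<Sum>m. q ^ (m\<^sup>2 + (l + 1) * m) / (qpoch q q m * qpoch q q (m + l))"
  shows "B l + q ^ (l + 1) * B (l + 1) = 1 / qpoch_inf q q"
proof -
  define b where "b l m = q ^ (m\<^sup>2 + (l + 1) * m) / (qpoch q q m * qpoch q q (m + l))" for l m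
  have "b l m + q ^ (l + 1) * b (l + 1) m
      = q ^ (m\<^sup>2 + (l + 1) * m) / (qpoch q q m * qpoch q q (m + (l + 1)))" for m
  proof -
    have "z / (P * R) + v * (z * x / (P * (R * (1 - v * x)))) = z / (P * (R * (1 - v * x)))"
      if "P \<noteq> 0" "R \<noteq> 0" "1 - v * x \<noteq> 0" for P R v x z :: complex
      using that by (simp add: divide_simps) (simp add: algebra_simps)
    from this[of "qpoch q q m" "qpoch q q (m + l)" "q ^ (l + 1)" "q ^ m"
        "q ^ (m\<^sup>2 + (l + 1) * m)"]
    show ?thesis
      using one_minus_power_nonzero[of "m + l"] qpoch_nonzero[of m] qpoch_nonzero[of "m + l"]
      by (simp add: b_def qpoch_Suc power_add power2_eq_square mult_ac)
  qed
  then have "(\<lambda>m. b l m + q ^ (l + 1) * b (l + 1) m) sums (1 / qpoch_inf q q)"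
    using durfee_rectangle_identity[of "l + 1"] by simp
  moreover have "(\<lambda>m. b l m + q ^ (l + 1) * b (l + 1) m) sums (B l + q ^ (l + 1) * B (l + 1))"
    unfolding b_def B_def by (intro sums_add sums_mult series_sums) auto
  ultimately show ?thesis
    using sums_unique2 by blast
qed

end

theorem theorem4p1:
  fixes q :: complex and l :: nat
  assumes "norm q < 1"
  shows "summable (\<lambda>s. (-1) ^ s * q ^ (s * (s + 1) div 2 + s * l)) \<and>
    (\<lambda>m. q ^ m / (qpoch q q m * qpoch q q (m + l))) sums
      (1 / (qpoch_inf q q)\<^sup>2 * (\<Sum>s. (-1) ^ s * q ^ (s * (s + 1) div 2 + s * l))) \<and>
    (\<lambda>m. q ^ (m\<^sup>2 + (l + 1) * m) / (qpoch q q m * qpoch q q (m + l))) sums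
      (1 / qpoch_inf q q * (\<Sum>s. (-1) ^ s * q ^ (s * (s + 1) div 2 + s * l)))"
proof (intro conjI)
  show "summable (\<lambda>s. (-1) ^ s * q ^ (s * (s + 1) div 2 + s * l))"
    by (rule alternating_summable[OF assms])
  obtain K where "\<And>k. norm (\<Sum>m. q ^ m / (qpoch q q m * qpoch q q (m + k))) \<le> K"
    using series_bounded[OF assms, of "\<lambda>k m. m"] by auto
  from bounded_recurrence_solution[OF assms first_series_recurrence[OF assms] this, of l]
  show "(\<lambda>m. q ^ m / (qpoch q q m * qpoch q q (m + l))) sums
      (1 / (qpoch_inf q q)\<^sup>2 * (\<Sum>s. (-1) ^ s * q ^ (s * (s + 1) div 2 + s * l)))"
    using series_sums[OF assms, of "\<lambda>m. m" l] by simp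
  obtain K where "\<And>k. norm (\<Sum>m. q ^ (m\<^sup>2 + (k + 1) * m) / (qpoch q q m * qpoch q q (m + k))) \<le> K"
    using series_bounded[OF assms, of "\<lambda>k m. m\<^sup>2 + (k + 1) * m"] by auto
  from bounded_recurrence_solution[OF assms second_series_recurrence[OF assms] this, of l]
  show "(\<lambda>m. q ^ (m\<^sup>2 + (l + 1) * m) / (qpoch q q m * qpoch q q (m + l))) sums
      (1 / qpoch_inf q q * (\<Sum>s. (-1) ^ s * q ^ (s * (s + 1) div 2 + s * l)))"
    using series_sums[OF assms, of "\<lambda>m. m\<^sup>2 + (l + 1) * m" l] by simp
qed

end
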